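(* Let $L/K$ be a field extension of degree $n$ and let $\mathfrak T=(n_1,\dots,n_t)$ be a tower type of degree $n$. Then the flag type $T(\mathfrak T)$ is realizable for $L/K$ (i.e. there is a flag $\mathcal F$ of $L$ over $K$ with $T_{\mathcal F}=T(\mathfrak T)$) if and only if $L/K$ has a tower of subfields \[K=L_0\subset L_1\subset\cdots\subset L_t=L\] such that $[L_i:L_{i-1}]=n_i$ and $L_i/L_{i-1}$ is a simple extension for all $1\le i\le t$.
   Context: For a positive integer $n$ let $[n]=\{0,\dots,n-1\}$. For a degree $n$ field extension $L/K$, a flag of $L$ over $K$ is an indexed family $\mathcal F=\{F_i\}_{i\in[n]}$ of $K$-subspaces of $L$ with $K=F_0\subset F_1\subset\cdots\subset F_{n-1}=L$ and $\dim_K F_i=i+1$. Its flag type is $T_{\mathcal F}:[n]\times[n]\to[n]$, $T_{\mathcal F}(i,j)=\min\{k\in[n]: F_iF_j\subseteq F_k\}$, where $F_iF_j$ is the $K$-span of all products $ab$ with $a\in F_i,b\in F_j$. A tower type of degree $n$ is a tuple $(n_1,\dots,n_t)$ of integers $>1$ with $n_1\cdots n_t=n$. Every $i\in[n]$ can be written uniquely in mixed radix notation as $i=i_1+i_2n_1+\cdots+i_tn_1\cdots n_{t-1}$ with $0\le i_s<n_s$. Let $H=C_{n_1}\times\cdots\times C_{n_t}$ (product of cyclic groups, written multiplicatively), $e_s$ a generator of the $s$-th factor, $v_i=e_1^{i_1}\cdots e_t^{i_t}$, $F_i=\{v_0,\dots,v_i\}$; $T(\mathfrak T):[n]\times[n]\to[n]$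 is $T(\mathfrak T)(i,j)=\min\{k: F_iF_j\subseteq F_k\}$ (products of subsets of $H$). *)

theory Defs
  imports "HOL-Algebra.Algebra"
begin

section \<open>Flags and their types\<close>

(* A field extension L/K is a field L (a ring record) with a subfield K of L; [L:K] = n is
   ring.dimension L n K (carrier L).  The library predicate subalgebra K V L only asks that V is an
   additive subgroup closed under multiplication by K, i.e. that V is a K-subspace of L.
   Families indexed by [n] = {0,...,n-1} are functions on nat whose values outside {..<n} are
   never used. *)

definition is_flag :: "('a, 'b) ring_scheme \<Rightarrow> 'a set \<Rightarrow> nat \<Rightarrow> (nat \<Rightarrow> 'a set) \<Rightarrow> bool" where
  "is_flag L K n F \<longleftrightarrow>
     (\<forall>i<n. subalgebra K (F i) L \<and> ring.dimension L (i + 1) K (F i)) \<and>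
     F 0 = K \<and> F (n - 1) = carrier L \<and>
     (\<forall>i. i + 1 < n \<longrightarrow> F i \<subset> F (i + 1))"

(* The library's Span is the span of a list of vectors. *)
definition span_of :: "('a, 'b) ring_scheme \<Rightarrow> 'a set \<Rightarrow> 'a set \<Rightarrow> 'a set" where
  "span_of L K S = (\<Union>Us \<in> {Us. set Us \<subseteq> S}. ring.Span L K Us)"

definition flag_type ::
  "('a, 'b) ring_scheme \<Rightarrow> 'a set \<Rightarrow> nat \<Rightarrow> (nat \<Rightarrow> 'a set) \<Rightarrow> nat \<Rightarrow> nat \<Rightarrow> nat" where
  "flag_type L K n F i j = Min {k \<in> {..<n}. span_of L K (F i <#>\<^bsub>L\<^esub> F j) \<subseteq> F k}"

definition realizable ::
  "('a, 'b) ring_scheme \<Rightarrow> 'a set \<Rightarrow> nat \<Rightarrow> (nat \<Rightarrow> nat \<Rightarrow> nat) \<Rightarrow> bool" where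
  "realizable L K n T \<longleftrightarrow>
     (\<exists>F. is_flag L K n F \<and> (\<forall>i<n. \<forall>j<n. flag_type L K n F i j = T i j))"

section \<open>Tower types\<close>

(* The empty tuple is the only tower type of degree 1. *)
definition tower_type :: "nat \<Rightarrow> nat list \<Rightarrow> bool" where
  "tower_type n ns \<longleftrightarrow> (\<forall>m \<in> set ns. m > 1) \<and> prod_list ns = n"

(* Tuples are 0-indexed: n_(s+1) is ns ! s, and its weight n_1 ... n_s is
   prod_list (take s ns). *)
definition mixed_digit :: "nat list \<Rightarrow> nat \<Rightarrow> nat \<Rightarrow> nat" where
  "mixed_digit ns i s = (i div prod_list (take s ns)) mod (ns ! s)"

definition tower_group :: "nat list \<Rightarrow> (nat \<Rightarrow> int) monoid" where
  "tower_group ns = product_group {..<length ns} (\<lambda>s. integer_mod_group (ns ! s))"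

(* The class of 1 is the chosen generator of each cyclic factor, which the library writes
   additively. *)
definition tower_gen :: "nat list \<Rightarrow> nat \<Rightarrow> nat \<Rightarrow> int" where
  "tower_gen ns s = (\<lambda>r\<in>{..<length ns}. if r = s then 1 else 0)"

definition tower_elem :: "nat list \<Rightarrow> nat \<Rightarrow> nat \<Rightarrow> int" where
  "tower_elem ns i =
     (\<Otimes>\<^bsub>tower_group ns\<^esub>s\<in>{..<length ns}. tower_gen ns s [^]\<^bsub>tower_group ns\<^esub> mixed_digit ns i s)"

definition tower_set :: "nat list \<Rightarrow> nat \<Rightarrow> (nat \<Rightarrow> int) set" where
  "tower_set ns i = tower_elem ns ` {..i}"

definition tower_flag_type :: "nat list \<Rightarrow> nat \<Rightarrow> nat \<Rightarrow> nat" where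
  "tower_flag_type ns i j =
     Min {k \<in> {..<prod_list ns}.
            tower_set ns i <#>\<^bsub>tower_group ns\<^esub> tower_set ns j \<subseteq> tower_set ns k}"

section \<open>Towers of simple extensions\<close>

(* E = M(x) for some x: field adjunction.  The library's simple_extension M x is the ring M[x]. *)
definition is_simple_extension :: "('a, 'b) ring_scheme \<Rightarrow> 'a set \<Rightarrow> 'a set \<Rightarrow> bool" where
  "is_simple_extension L M E \<longleftrightarrow> (\<exists>x\<in>E. E = generate_field L (insert x M))"

definition is_simple_tower ::
  "('a, 'b) ring_scheme \<Rightarrow> 'a set \<Rightarrow> nat list \<Rightarrow> (nat \<Rightarrow> 'a set) \<Rightarrow> bool" where
  "is_simple_tower L K ns M \<longleftrightarrow>
     (\<forall>s\<le>length ns. subfield (M s) L) \<and>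
     M 0 = K \<and> M (length ns) = carrier L \<and>
     (\<forall>s<length ns. M s \<subset> M (s + 1) \<and>
        ring.dimension L (ns ! s) (M s) (M (s + 1)) \<and>
        is_simple_extension L (M s) (M (s + 1)))"

section \<open>The digits and the elements of the group\<close>

lemma mixed_digit_expansion_aux:
  assumes "t \<le> length ns"
  shows "i = (\<Sum>s<t. mixed_digit ns i s * prod_list (take s ns))
             + (i div prod_list (take t ns)) * prod_list (take t ns)"
  using assms
proof (induction t)
  case (Suc t)
  let ?p = "prod_list (take t ns)"
  have p: "prod_list (take (Suc t) ns) = ?p * ns ! t"
    using Suc.prems by (simp add: take_Suc_conv_app_nth)
  have "i div ?p * ?p = mixed_digit ns i t * ?p + (i div (?p * ns ! t)) * (?p * ns ! t)"
  proof -
    have "i div ?p = (i div ?p) mod (ns ! t) + (i div ?p) div (ns ! t) * (ns ! t)"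
      by (metis add.commute div_mult_mod_eq)
    then have "i div ?p * ?p
        = ((i div ?p) mod (ns ! t) + (i div ?p) div (ns ! t) * (ns ! t)) * ?p"
      by (rule arg_cong)
    also have "\<dots> = (i div ?p) mod (ns ! t) * ?p
        + (i div ?p) div (ns ! t) * (?p * ns ! t)"
      by (simp add: add_mult_distrib mult.assoc mult.commute[of "ns ! t"])
    finally show ?thesis
      unfolding mixed_digit_def div_mult2_eq .
  qed
  then show ?case using Suc p by simp
qed simp

lemma mixed_digit_less:
  assumes "tower_type n ns" "s < length ns"
  shows "mixed_digit ns i s < ns ! s"
proof -
  have "ns ! s > 1" using assms unfolding tower_type_def by (meson nth_mem)
  then show ?thesis unfolding mixed_digit_def by simp
qed

lemma mixed_digit_expansion:
  assumes "tower_type n ns" "i < n"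
  shows "i = (\<Sum>s<length ns. mixed_digit ns i s * prod_list (take s ns))"
  using mixed_digit_expansion_aux[of "length ns" ns i] assms by (simp add: tower_type_def)

lemma comm_group_tower_group: "comm_group (tower_group ns)"
proof -
  have "group (tower_group ns)" unfolding tower_group_def by simp
  moreover have "comm_monoid (tower_group ns)"
    using calculation
    by (intro group.group_comm_groupI[THEN comm_group.axioms(1)])
       (auto simp: tower_group_def add.commute intro!: restrict_ext)
  ultimately show ?thesis by (simp add: comm_group_def)
qed

lemma tower_gen_closed:
  assumes "tower_type n ns"
  shows "tower_gen ns s \<in> carrier (tower_group ns)"
proof -
  have "ns ! r > 1" if "r < length ns" for r
    using assms that unfolding tower_type_def by (meson nth_mem)
  then have "(if r = s then 1 else 0) \<in> carrier (integer_mod_group (ns ! r))"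
    if "r < length ns" for r
    using that by (fastforce simp: carrier_integer_mod_group)
  then show ?thesis
    by (simp add: tower_gen_def tower_group_def PiE_iff)
qed

lemma tower_gen_pow:
  "tower_gen ns s [^]\<^bsub>tower_group ns\<^esub> (m::nat)
     = (\<lambda>r\<in>{..<length ns}. if r = s then int m mod int (ns ! r) else 0)"
proof (induction m)
  case 0
  then show ?case by (auto simp: tower_group_def nat_pow_def intro!: restrict_ext)
next
  case (Suc m)
  have "tower_gen ns s [^]\<^bsub>tower_group ns\<^esub> Suc m
      = tower_gen ns s [^]\<^bsub>tower_group ns\<^esub> m \<otimes>\<^bsub>tower_group ns\<^esub> tower_gen ns s"
    by (simp add: nat_pow_def)
  also have "\<dots> = (\<lambda>r\<in>{..<length ns}. if r = s then int (Suc m) mod int (ns ! r) else 0)"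
    unfolding Suc
    by (auto simp: tower_group_def tower_gen_def mod_add_left_eq mod_add_right_eq add.commute
             intro!: restrict_ext)
  finally show ?case .
qed

lemma tower_elem_eq:
  assumes "tower_type n ns"
  shows "tower_elem ns i = (\<lambda>s\<in>{..<length ns}. int (mixed_digit ns i s))"
proof -
  interpret G: comm_group "tower_group ns" by (rule comm_group_tower_group)
  let ?f = "\<lambda>s. tower_gen ns s [^]\<^bsub>tower_group ns\<^esub> mixed_digit ns i s"
  have cl: "?f s \<in> carrier (tower_group ns)" for s
    using tower_gen_closed[OF assms] by simp
  have d: "int (mixed_digit ns i r) mod int (ns ! r) = int (mixed_digit ns i r)"
    if "r < length ns" for r
    using mixed_digit_less[OF assms that, of i] by simp
  have "(\<Otimes>\<^bsub>tower_group ns\<^esub>s\<in>A. ?f s)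
      = (\<lambda>r\<in>{..<length ns}. if r \<in> A then int (mixed_digit ns i r) else 0)"
    if "finite A" for A
    using that
  proof (induction A)
    case empty
    have "\<one>\<^bsub>tower_group ns\<^esub> = (\<lambda>r\<in>{..<length ns}. 0)"
      by (simp add: tower_group_def)
    then show ?case by simp
  next
    case (insert a A)
    have "(\<Otimes>\<^bsub>tower_group ns\<^esub>s\<in>insert a A. ?f s)
        = ?f a \<otimes>\<^bsub>tower_group ns\<^esub> (\<Otimes>\<^bsub>tower_group ns\<^esub>s\<in>A. ?f s)"
      using insert.hyps cl by (intro G.finprod_insert) auto
    also have "\<dots> = ?f a \<otimes>\<^bsub>tower_group ns\<^esub>
        (\<lambda>r\<in>{..<length ns}. if r \<in> A then int (mixed_digit ns i r) else 0)"
      by (simp only: insert.IH)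
    also have "\<dots>
        = (\<lambda>r\<in>{..<length ns}. if r \<in> insert a A then int (mixed_digit ns i r) else 0)"
      unfolding tower_gen_pow
      using insert.hyps d by (auto simp: tower_group_def intro!: restrict_ext)
    finally show ?case .
  qed
  from this[of "{..<length ns}"] show ?thesis
    unfolding tower_elem_def by (auto intro!: restrict_ext)
qed

end

theory Submission
  imports Defs
begin

text \<open>
  Multiplication in the group adds digits without carrying. In a flag of this type, the member of
  dimension \<open>n\<^sub>1 \<dots> n\<^sub>s\<close> is closed under multiplication, hence a
  subfield; an index strictly between two consecutive such dimensions is a carry-free sum of two
  smaller indices, so from there on each member of the flag is obtained from its predecessor by
  adjoining a product of elements already present, and every layer is generated by one element.
  Conversely, the monomials in the generators of a tower, ordered by mixed radix notation, span a
  flag. A product of two monomials whose digits produce a carry is only known to lie in a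
  subfield times a monomial, but this is no larger than what carry-free pairs of smaller indices
  already contribute.
\<close>

subsection \<open>Digitwise addition in mixed radix notation\<close>

text \<open>Besides being the place value of digit \<open>s\<close>, this is the degree over the
  base of the \<open>s\<close>-th field in a tower of type \<open>ns\<close>.\<close>

definition weight :: "nat list \<Rightarrow> nat \<Rightarrow> nat" where
  "weight ns s = prod_list (take s ns)"

text \<open>The group law of \<open>tower_group ns\<close> read on indices
  (\<open>tower_elem_mult\<close>): each digit is reduced on its own, and a carry is dropped instead
  of being passed on.\<close>

definition digit_add :: "nat list \<Rightarrow> nat \<Rightarrow> nat \<Rightarrow> nat" where
  "digit_add ns a b =
     (\<Sum>s<length ns. ((mixed_digit ns a s + mixed_digit ns b s) mod (ns ! s)) * weight ns s)"

lemma weight_0 [simp]: "weight ns 0 = 1"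
  by (simp add: weight_def)

lemma weight_Suc: "s < length ns \<Longrightarrow> weight ns (Suc s) = weight ns s * ns ! s"
  by (simp add: weight_def take_Suc_conv_app_nth)

lemma weight_dvd: "s \<le> r \<Longrightarrow> weight ns s dvd weight ns r"
proof -
  assume "s \<le> r"
  then have "take r ns = take s ns @ take (r - s) (drop s ns)"
    by (metis le_add_diff_inverse take_add)
  then show ?thesis by (simp add: weight_def)
qed

locale tower_degree =
  fixes n :: nat and ns :: "nat list"
  assumes tower_type: "tower_type n ns"
begin

lemma radix_gt_1: "s < length ns \<Longrightarrow> ns ! s > 1"
  using tower_type by (simp add: tower_type_def)

lemma radix_pos: "s < length ns \<Longrightarrow> ns ! s > 0"
  using radix_gt_1[of s] by simp

lemma weight_length [simp]: "weight ns (length ns) = n"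
  using tower_type by (simp add: tower_type_def weight_def)

lemma weight_pos: "weight ns s > 0"
proof -
  have "0 \<notin> set (take s ns)"
    using tower_type unfolding tower_type_def by (metis in_set_takeD less_nat_zero_code)
  then have "weight ns s \<noteq> 0" unfolding weight_def using prod_list_zero_iff[of "take s ns"] by blast
  then show ?thesis by simp
qed

lemma degree_pos: "n > 0"
  using weight_pos[of "length ns"] by simp

lemma weight_mono: "s \<le> r \<Longrightarrow> weight ns s \<le> weight ns r"
  by (rule dvd_imp_le[OF weight_dvd weight_pos])

lemma weight_less_Suc: "s < length ns \<Longrightarrow> weight ns s < weight ns (Suc s)"
  using radix_gt_1[of s] weight_pos[of s] by (simp add: weight_Suc)

lemma weight_le_degree: "s \<le> length ns \<Longrightarrow> weight ns s \<le> n"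
  using weight_mono[of s "length ns"] by simp

lemma mixed_digit_high:
  assumes "a < weight ns s" "s \<le> r"
  shows "mixed_digit ns a r = 0"
  using assms weight_mono[of s r] by (simp add: mixed_digit_def weight_def)

lemma block_less:
  assumes "s < length ns" "d < ns ! s" "a < weight ns s"
  shows "d * weight ns s + a < weight ns (Suc s)"
proof -
  have "d * weight ns s + a < Suc d * weight ns s" using assms by simp
  also have "\<dots> \<le> ns ! s * weight ns s" using assms by (intro mult_right_mono) auto
  finally show ?thesis using assms by (simp add: weight_Suc mult.commute)
qed

lemma mixed_digit_block:
  assumes "s < length ns" "d < ns ! s" "a < weight ns s"
  shows "mixed_digit ns (d * weight ns s + a) r =
           (if r < s then mixed_digit ns a r else if r = s then d else 0)"
proof -
  consider "r < s" | "r = s" | "s < r" by linarith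
  then show ?thesis
  proof cases
    case 1
    then have "weight ns (Suc r) dvd weight ns s" by (simp add: weight_dvd)
    \<comment> \<open>Since \<open>weight ns s\<close> is a multiple of
      \<open>weight ns r * ns ! r\<close>, adding \<open>d\<close> copies of it changes the quotient
      by \<open>weight ns r\<close> only by a multiple of \<open>ns ! r\<close>, so digit
      \<open>r\<close> stays.\<close>
    then obtain q where q: "weight ns s = weight ns r * ns ! r * q"
      using 1 assms(1) by (auto simp: weight_Suc dvd_def)
    have "(d * weight ns s + a) div weight ns r = d * q * ns ! r + a div weight ns r"
    proof -
      have "d * weight ns s + a = a + (d * q * ns ! r) * weight ns r"
        unfolding q by (simp add: ac_simps)
      then have "(d * weight ns s + a) div weight ns r = (a + (d * q * ns ! r) * weight ns r) div weight ns r"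
        by (rule arg_cong)
      also have "\<dots> = d * q * ns ! r + a div weight ns r"
        using weight_pos[of r] by (intro div_mult_self1) simp
      finally show ?thesis .
    qed
    then show ?thesis using 1 by (simp add: mixed_digit_def weight_def)
  next
    case 2
    have "(d * weight ns s + a) div weight ns s = d" using assms weight_pos[of s] by simp
    then show ?thesis using 2 assms by (simp add: mixed_digit_def weight_def)
  next
    case 3
    then show ?thesis using mixed_digit_high[OF block_less[OF assms], of r] by simp
  qed
qed

lemma block_cases:
  assumes "s < length ns" "a < weight ns (Suc s)"
  obtains d a0 where "d < ns ! s" "a0 < weight ns s" "a = d * weight ns s + a0"
proof
  show "a div weight ns s < ns ! s"
    using assms weight_pos[of s] by (simp add: weight_Suc less_mult_imp_div_less mult.commute)
  show "a mod weight ns s < weight ns s" using weight_pos[of s] by simp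
  show "a = a div weight ns s * weight ns s + a mod weight ns s"
    by (rule div_mult_mod_eq[symmetric])
qed

lemma digit_sum:
  assumes "t \<le> length ns" "\<And>s. s < t \<Longrightarrow> f s < ns ! s"
  shows "(\<Sum>s<t. f s * weight ns s) < weight ns t"
    and "\<And>r. mixed_digit ns (\<Sum>s<t. f s * weight ns s) r = (if r < t then f r else 0)"
proof -
  \<comment> \<open>The size bound is what lets \<open>mixed_digit_block\<close> attach the next
    digit, so both claims pass through the induction together.\<close>
  have "(\<Sum>s<t. f s * weight ns s) < weight ns t \<and>
      (\<forall>r. mixed_digit ns (\<Sum>s<t. f s * weight ns s) r = (if r < t then f r else 0))"
    using assms
  proof (induction t)
    case 0
    then show ?case by (simp add: mixed_digit_def)
  next
    case (Suc t)
    then have "(\<Sum>s<t. f s * weight ns s) < weight ns t"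
      "\<And>r. mixed_digit ns (\<Sum>s<t. f s * weight ns s) r = (if r < t then f r else 0)"
      by auto
    moreover have "t < length ns" "f t < ns ! t" using Suc.prems by auto
    ultimately show ?case
      using block_less[of t "f t" "\<Sum>s<t. f s * weight ns s"]
        mixed_digit_block[of t "f t" "\<Sum>s<t. f s * weight ns s"]
      by (auto simp: add.commute less_Suc_eq)
  qed
  then show "(\<Sum>s<t. f s * weight ns s) < weight ns t"
    and "\<And>r. mixed_digit ns (\<Sum>s<t. f s * weight ns s) r = (if r < t then f r else 0)"
    by auto
qed

lemma digit_add_less: "digit_add ns a b < n"
  and mixed_digit_digit_add: "s < length ns \<Longrightarrow>
    mixed_digit ns (digit_add ns a b) s = (mixed_digit ns a s + mixed_digit ns b s) mod (ns ! s)"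
proof -
  have *: "\<And>s. s < length ns \<Longrightarrow>
      (mixed_digit ns a s + mixed_digit ns b s) mod (ns ! s) < ns ! s"
    using mod_less_divisor[OF radix_pos] by blast
  show "digit_add ns a b < n"
    using digit_sum(1)[of "length ns", OF _ *] by (simp add: digit_add_def)
  show "mixed_digit ns (digit_add ns a b) s = (mixed_digit ns a s + mixed_digit ns b s) mod (ns ! s)"
    if "s < length ns"
    using digit_sum(2)[of "length ns", OF _ *, of s] that by (simp add: digit_add_def)
qed

lemma digit_eqI:
  assumes "a < n" "b < n" "\<And>s. s < length ns \<Longrightarrow> mixed_digit ns a s = mixed_digit ns b s"
  shows "a = b"
proof -
  have "(\<Sum>s<length ns. mixed_digit ns a s * prod_list (take s ns)) =
      (\<Sum>s<length ns. mixed_digit ns b s * prod_list (take s ns))"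
    by (intro sum.cong) (auto simp: assms(3))
  then show ?thesis
    by (simp only: mixed_digit_expansion[OF tower_type, symmetric] assms(1,2))
qed

text \<open>Numbers below \<open>weight ns s\<close> have no digits from position \<open>s\<close>
  on, so the leading digits meet only each other, and whatever overflows from position
  \<open>s\<close> disappears.\<close>

lemma digit_add_block:
  assumes "s < length ns" "d < ns ! s" "e < ns ! s" "a < weight ns s" "b < weight ns s"
  shows "digit_add ns (d * weight ns s + a) (e * weight ns s + b) =
           ((d + e) mod (ns ! s)) * weight ns s + digit_add ns a b"
proof -
  let ?g = "\<lambda>a b r. ((mixed_digit ns a r + mixed_digit ns b r) mod (ns ! r)) * weight ns r"
  have z: "mixed_digit ns a r = 0" "mixed_digit ns b r = 0" if "s \<le> r" for r
    using that assms mixed_digit_high by auto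
  have "digit_add ns (d * weight ns s + a) (e * weight ns s + b) =
      (\<Sum>r<length ns. (if r = s then ((d + e) mod (ns ! s)) * weight ns s else 0) + ?g a b r)"
    unfolding digit_add_def
    by (intro sum.cong) (use z assms in \<open>auto simp: mixed_digit_block\<close>)
  also have "\<dots> = ((d + e) mod (ns ! s)) * weight ns s + digit_add ns a b"
    unfolding sum.distrib digit_add_def using assms(1) by simp
  finally show ?thesis .
qed

lemma digit_add_0_right:
  assumes "a < n" shows "digit_add ns a 0 = a"
proof (rule digit_eqI[OF digit_add_less assms])
  fix s assume s: "s < length ns"
  have "mixed_digit ns 0 s = 0" by (simp add: mixed_digit_def)
  then show "mixed_digit ns (digit_add ns a 0) s = mixed_digit ns a s"
    using mixed_digit_digit_add[OF s, of a 0] mixed_digit_less[OF tower_type s, of a] by simp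
qed

lemma add_eq_digit_sum:
  assumes "a < n" "b < n"
  shows "a + b = (\<Sum>s<length ns. (mixed_digit ns a s + mixed_digit ns b s) * weight ns s)"
  unfolding add_mult_distrib sum.distrib weight_def
  by (simp only: mixed_digit_expansion[OF tower_type, symmetric] assms)

lemma digit_add_le:
  assumes "a < n" "b < n"
  shows "digit_add ns a b \<le> a + b"
  unfolding digit_add_def add_eq_digit_sum[OF assms] by (intro sum_mono) simp

text \<open>The equation \<open>digit_add ns a b = a + b\<close> expresses carry-freeness
  throughout. Reduction can only lower each term of the digit sum, so equal totals force equality in
  every term.\<close>

lemma carry_free_digits:
  assumes "a < n" "b < n" "digit_add ns a b = a + b" "s < length ns"
  shows "mixed_digit ns a s + mixed_digit ns b s < ns ! s"
proof -
  have "((mixed_digit ns a s + mixed_digit ns b s) mod (ns ! s)) * weight ns s =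
      (mixed_digit ns a s + mixed_digit ns b s) * weight ns s"
    using assms(3) unfolding add_eq_digit_sum[OF assms(1,2)] digit_add_def
    by (rule sum_mono_inv) (use assms(4) in auto)
  then have "(mixed_digit ns a s + mixed_digit ns b s) mod (ns ! s) =
      mixed_digit ns a s + mixed_digit ns b s"
    using weight_pos[of s] by simp
  then show ?thesis using mod_less_divisor[OF radix_pos[OF assms(4)]] by metis
qed

lemma digit_add_less_weight:
  assumes "s \<le> length ns" "a < weight ns s" "b < weight ns s"
  shows "digit_add ns a b < weight ns s"
proof -
  let ?g = "\<lambda>r. (mixed_digit ns a r + mixed_digit ns b r) mod (ns ! r)"
  have "digit_add ns a b = (\<Sum>r<s. ?g r * weight ns r)"
    unfolding digit_add_def
    by (rule sum.mono_neutral_right) (use assms in \<open>auto simp: mixed_digit_high\<close>)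
  also have "\<dots> < weight ns s"
    using assms radix_pos by (intro digit_sum(1)) auto
  finally show ?thesis .
qed

text \<open>All digits of \<open>weight ns s - 1\<close> below position \<open>s\<close> are
  maximal, so subtracting \<open>b\<close> never borrows and adding it back never carries.\<close>

lemma digit_add_complement:
  assumes "s \<le> length ns" "b < weight ns s"
  shows "digit_add ns (weight ns s - 1 - b) b = weight ns s - 1"
  using assms
proof (induction s arbitrary: b)
  case 0
  then show ?case using degree_pos by (simp add: digit_add_0_right)
next
  case (Suc s)
  then have s: "s < length ns" by simp
  obtain e b0 where e: "e < ns ! s" "b0 < weight ns s" "b = e * weight ns s + b0"
    using block_cases[OF s Suc.prems(2)] by metis
  \<comment> \<open>Leading digit of the complement of \<open>b\<close>; what remains is the
    complement of \<open>b0\<close> one level below.\<close>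
  define d where "d = ns ! s - 1 - e"
  have d: "d < ns ! s" "ns ! s = d + e + 1" using e by (auto simp: d_def)
  have "weight ns (Suc s) = d * weight ns s + e * weight ns s + weight ns s"
    unfolding weight_Suc[OF s] d(2) by (simp add: add_mult_distrib2)
  then have c: "weight ns (Suc s) - 1 - b = d * weight ns s + (weight ns s - 1 - b0)"
    and c': "weight ns (Suc s) - 1 = (d + e) * weight ns s + (weight ns s - 1)"
    using e weight_pos[of s] by (simp_all add: add_mult_distrib)
  have "digit_add ns (weight ns (Suc s) - 1 - b) b =
      ((d + e) mod (ns ! s)) * weight ns s + digit_add ns (weight ns s - 1 - b0) b0"
    unfolding c unfolding e(3) using s e(1,2) d(1) weight_pos[of s] by (intro digit_add_block) auto
  also have "\<dots> = weight ns (Suc s) - 1"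
    using Suc.IH[of b0] s e(2) d(2) c' by simp
  finally show ?case .
qed

section \<open>The flag type of a tower type in terms of digits\<close>

lemma tower_elem_mult:
  "tower_elem ns a \<otimes>\<^bsub>tower_group ns\<^esub> tower_elem ns b = tower_elem ns (digit_add ns a b)"
  unfolding tower_elem_eq[OF tower_type]
  by (auto simp: tower_group_def mixed_digit_digit_add zmod_int intro!: restrict_ext)

lemma inj_on_tower_elem: "inj_on (tower_elem ns) {..<n}"
proof (rule inj_onI)
  fix a b assume ab: "a \<in> {..<n}" "b \<in> {..<n}" "tower_elem ns a = tower_elem ns b"
  show "a = b"
  proof (rule digit_eqI)
    fix s assume "s < length ns"
    then show "mixed_digit ns a s = mixed_digit ns b s"
      using fun_cong[OF ab(3), of s] unfolding tower_elem_eq[OF tower_type] by simp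
  qed (use ab in auto)
qed

lemma tower_set_mult_subset_iff:
  assumes "k < n"
  shows "tower_set ns i <#>\<^bsub>tower_group ns\<^esub> tower_set ns j \<subseteq> tower_set ns k \<longleftrightarrow>
           (\<forall>a\<le>i. \<forall>b\<le>j. digit_add ns a b \<le> k)"
proof -
  have "tower_elem ns (digit_add ns a b) \<in> tower_set ns k \<longleftrightarrow> digit_add ns a b \<le> k" for a b
  proof -
    \<comment> \<open>Injectivity holds on indices below \<open>n\<close>, and \<open>k < n\<close>
      keeps \<open>{..k}\<close> among them.\<close>
    have "tower_elem ns (digit_add ns a b) \<in> tower_elem ns ` {..k} \<longleftrightarrow> digit_add ns a b \<in> {..k}"
      by (rule inj_on_image_mem_iff[OF inj_on_tower_elem]) (use assms digit_add_less in auto)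
    then show ?thesis by (simp add: tower_set_def)
  qed
  moreover have "tower_set ns i <#>\<^bsub>tower_group ns\<^esub> tower_set ns j \<subseteq> tower_set ns k \<longleftrightarrow>
      (\<forall>a\<le>i. \<forall>b\<le>j. tower_elem ns (digit_add ns a b) \<in> tower_set ns k)"
    by (subst (1 2) tower_set_def) (auto simp: set_mult_def tower_elem_mult)
  ultimately show ?thesis by simp
qed

lemma tower_flag_type_eq:
  "tower_flag_type ns i j = Min {k \<in> {..<n}. \<forall>a\<le>i. \<forall>b\<le>j. digit_add ns a b \<le> k}"
proof -
  have "prod_list ns = n" using tower_type by (simp add: tower_type_def)
  then have "{k \<in> {..<prod_list ns}.
        tower_set ns i <#>\<^bsub>tower_group ns\<^esub> tower_set ns j \<subseteq> tower_set ns k} =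
      {k \<in> {..<n}. \<forall>a\<le>i. \<forall>b\<le>j. digit_add ns a b \<le> k}"
    by (intro Collect_cong conj_cong) (simp_all add: tower_set_mult_subset_iff)
  then show ?thesis unfolding tower_flag_type_def by simp
qed

end

subsection \<open>Linear algebra over subfields\<close>

text \<open>Keeps the simplifier from unfolding \<open>Span K (u # Us)\<close> into a line
  extension, so that facts about spans still match.\<close>

declare (in ring) Span.simps [simp del]

lemma (in ring) subfield_is_subalgebra:
  assumes "subfield M R" "K \<subseteq> M"
  shows "subalgebra K M R"
proof -
  have "subring M R" using assms(1) by (rule subfieldE(1))
  then show ?thesis
    unfolding subalgebra_def subalgebra_axioms_def
    using assms(2) subring.axioms(1)[of M R] subringE(6)[of M R] by (simp add: subset_iff)
qed

lemma (in ring) subalgebra_antimono: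
  assumes "subalgebra M V R" "K \<subseteq> M"
  shows "subalgebra K V R"
  using assms by (auto simp: subalgebra_def subalgebra_axioms_def)

text \<open>This is the preimage of \<open>V\<close> under the \<open>K\<close>-linear map sending
  \<open>c\<close> to \<open>c \<otimes> y\<close>. It allows a claim about products to be checked
  on a spanning set of the left factors.\<close>

lemma (in ring) subalgebra_colon:
  assumes "K \<subseteq> carrier R" "subalgebra K V R" "y \<in> carrier R"
  shows "subalgebra K {c \<in> carrier R. c \<otimes> y \<in> V} R"
proof -
  interpret V: subalgebra K V R by (rule assms(2))
  show ?thesis
  proof (intro subalgebra.intro subalgebra_axioms.intro add.subgroupI)
    have "\<zero> \<in> {c \<in> carrier R. c \<otimes> y \<in> V}"
      using V.one_closed assms(3) by simp
    then show "{c \<in> carrier R. c \<otimes> y \<in> V} \<noteq> {}" by blast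
  next
    fix a assume "a \<in> {c \<in> carrier R. c \<otimes> y \<in> V}"
    then show "\<ominus> a \<in> {c \<in> carrier R. c \<otimes> y \<in> V}"
      using V.m_inv_closed[of "a \<otimes> y"] assms(3) by (simp add: l_minus a_inv_def[symmetric])
  next
    fix a b assume "a \<in> {c \<in> carrier R. c \<otimes> y \<in> V}" "b \<in> {c \<in> carrier R. c \<otimes> y \<in> V}"
    then show "a \<oplus> b \<in> {c \<in> carrier R. c \<otimes> y \<in> V}"
      using V.m_closed[of "a \<otimes> y" "b \<otimes> y"] assms(3) by (simp add: l_distr)
  next
    fix k v assume "k \<in> K" "v \<in> {c \<in> carrier R. c \<otimes> y \<in> V}"
    then show "k \<otimes> v \<in> {c \<in> carrier R. c \<otimes> y \<in> V}"
      using V.smult_closed[of k "v \<otimes> y"] assms(1,3) by (auto simp: m_assoc)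
  qed auto
qed

text \<open>Frees flag types of the span and leaves plain products of elements. Each generator lies
  in its own one-element span, which gives the forward direction.\<close>

lemma (in ring) span_of_subset_iff:
  assumes "subfield K R" "subalgebra K V R" "S \<subseteq> carrier R"
  shows "span_of R K S \<subseteq> V \<longleftrightarrow> S \<subseteq> V"
proof
  assume span: "span_of R K S \<subseteq> V"
  show "S \<subseteq> V"
  proof
    fix s assume "s \<in> S"
    then have "s \<in> Span K [s]" "[s] \<in> {Us. set Us \<subseteq> S}"
      using Span_base_incl[OF assms(1), of "[s]"] assms(3) by auto
    then show "s \<in> V" using span unfolding span_of_def by blast
  qed
next
  assume "S \<subseteq> V"
  then show "span_of R K S \<subseteq> V"
    unfolding span_of_def
    by (intro UN_least subalgebra_Span_incl[OF assms(1,2)]) auto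
qed

text \<open>The point is the inverses. A nonzero \<open>x\<close> is algebraic because
  \<open>V\<close> is finite-dimensional, so the ring \<open>K[x]\<close> is already a field; it
  contains the inverse and lies in \<open>V\<close>.\<close>

lemma (in field) finite_dimension_subalgebra_is_subfield:
  assumes K: "subfield K R" and V: "subalgebra K V R" "finite_dimension K V" "\<one> \<in> V"
    and mult: "\<And>a b. \<lbrakk> a \<in> V; b \<in> V \<rbrakk> \<Longrightarrow> a \<otimes> b \<in> V"
  shows "subfield V R"
proof (rule subfieldI')
  interpret V: subalgebra K V R by (rule V(1))
  have carr: "V \<subseteq> carrier R" by (rule subalgebra_in_carrier[OF V(1)])
  show sub: "subring V R"
    using V.m_closed V.m_inv_closed V(3) mult carr
    by (intro subringI) (auto simp: a_inv_def)
  have KV: "K \<subseteq> V"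
  proof
    fix k assume "k \<in> K"
    then show "k \<in> V" using V.smult_closed[of k \<one>] V(3) subfieldE(3)[OF K] by auto
  qed
  fix x assume x: "x \<in> V - {\<zero>}"
  then have alg: "(algebraic over K) x"
    using finite_dimension_imp_algebraic[OF K sub V(2)] by simp
  have "subfield (simple_extension K x) R"
    using simple_extension_is_subfield[OF K] alg x carr by auto
  moreover have "x \<in> simple_extension K x"
    using simple_extension_mem[OF subfieldE(1)[OF K]] x carr by auto
  ultimately have "inv x \<in> simple_extension K x"
    using subfield_m_inv(1)[of "simple_extension K x" x] x by auto
  then show "inv x \<in> V"
    using simple_extension_subring_incl[OF sub KV] x by auto
qed

text \<open>A \<open>K\<close>-basis of \<open>E\<close> still spans \<open>E\<close> over the
  larger field \<open>M\<close>.\<close>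

lemma (in ring) finite_dimension_over_intermediate:
  assumes K: "subfield K R" and M: "subfield M R" "K \<subseteq> M"
    and E: "finite_dimension K E" "subalgebra M E R"
  shows "finite_dimension M E"
proof -
  obtain Us where Us: "set Us \<subseteq> carrier R" "Span K Us = E"
    using exists_base[OF K finite_dimensionE[OF K E(1)]] by auto
  have "set Us \<subseteq> E" using Span_base_incl[OF K Us(1)] Us(2) by simp
  then have "Span M Us \<subseteq> E" by (rule subalgebra_Span_incl[OF M(1) E(2)])
  moreover have "E \<subseteq> Span M Us"
    using subalgebra_Span_incl[OF K subalgebra_antimono[OF Span_is_subalgebra[OF M(1) Us(1)] M(2)]]
      Span_base_incl[OF M(1) Us(1)] Us(2) by auto
  ultimately show ?thesis using Span_finite_dimension[OF M(1) Us(1)] by auto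
qed

text \<open>Either the head already lies in the span of an independent tail, or the tail is
  dependent, loses a dimension by induction, and the head restores at most one.\<close>

lemma (in ring) dependent_Span_dimension_less:
  assumes K: "subfield K R"
  shows "\<lbrakk> set Us \<subseteq> carrier R; dimension m K (Span K Us); dependent K Us \<rbrakk> \<Longrightarrow> m < length Us"
proof (induction Us arbitrary: m)
  case (Cons u Us)
  show ?case
  proof (cases "independent K Us")
    case True
    then have "u \<in> Span K Us"
      using Cons.prems by (auto intro: li_Cons)
    then have "Span K (u # Us) = Span K Us"
      using mono_Span_subset[OF K, of "u # Us" Us] mono_Span[OF K, of Us u]
        Span_base_incl[OF K, of Us] Cons.prems(1) by auto
    then have "m = length Us"
      using dimension_is_inj[OF K] dimension_independent[OF True] Cons.prems(2) by auto
    then show ?thesis by simp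
  next
    case False
    have Us: "set Us \<subseteq> carrier R" "u \<in> carrier R" using Cons.prems(1) by auto
    obtain Vs where Vs: "independent K Vs" "Span K Vs = Span K Us"
      using filter_base[OF K Us(1)] by metis
    have d: "dimension (length Vs) K (Span K Us)" using dimension_independent[OF Vs(1)] Vs(2) by simp
    have "length Vs < length Us" by (rule Cons.IH[OF Us(1) d False])
    moreover have "m \<le> Suc (length Vs)"
    proof (cases "u \<in> Span K Us")
      case True
      then have "Span K (u # Us) = Span K Us"
        using mono_Span_subset[OF K, of "u # Us" Us] mono_Span[OF K, of Us u]
          Span_base_incl[OF K, of Us] Us by auto
      then show ?thesis using dimension_is_inj[OF K d] Cons.prems(2) by auto
    next
      case False
      then have "dimension (Suc (length Vs)) K (Span K (u # Us))"
        using Suc_dim[OF Us(2) False d] by (simp add: Span.simps)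
      then show ?thesis using dimension_is_inj[OF K] Cons.prems(2) by auto
    qed
    ultimately show ?thesis by simp
  qed
qed simp

lemma (in ring) spanning_list_independent:
  assumes "subfield K R" "set Us \<subseteq> carrier R" "dimension (length Us) K (Span K Us)"
  shows "independent K Us"
  using dependent_Span_dimension_less[OF assms] by blast

text \<open>Bridges field adjunction and the library's ring \<open>M[x]\<close>. Finite dimension
  makes \<open>x\<close> algebraic, so the two coincide, and \<open>m\<close> is the degree of the
  minimal polynomial.\<close>

lemma (in field) simple_extension_eq_Span:
  assumes M: "subfield M R" and x: "x \<in> carrier R"
    and d: "dimension m M (generate_field R (insert x M))"
  shows "generate_field R (insert x M) = Span M (exp_base x m)"
proof -
  let ?E = "generate_field R (insert x M)"
  have sub: "insert x M \<subseteq> carrier R" using x subfieldE(3)[OF M] by simp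
  have E: "subfield ?E R" by (rule generate_field_is_subfield[OF sub])
  have incl: "insert x M \<subseteq> ?E" by (auto intro: generate_field.incl)
  have alg: "(algebraic over M) x"
    using finite_dimension_imp_algebraic[OF M subfieldE(1)[OF E] finite_dimensionI[OF d]] incl by simp
  have "subfield (simple_extension M x) R"
    using simple_extension_is_subfield[OF M x] alg by simp
  moreover have "insert x M \<subseteq> simple_extension M x"
    using simple_extension_incl[OF subfieldE(3)[OF M] x] simple_extension_mem[OF subfieldE(1)[OF M] x]
    by simp
  ultimately have "?E \<subseteq> simple_extension M x"
    by (rule generate_field_min_subfield1[OF sub])
  moreover have "simple_extension M x \<subseteq> ?E"
    using simple_extension_subring_incl[OF subfieldE(1)[OF E]] incl by simp
  ultimately have eq: "simple_extension M x = ?E" by simp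
  then have "degree (Irr M x) = m"
    using dimension_is_inj[OF M dimension_simple_extension[OF M x alg]] d by simp
  then show ?thesis using Span_exp_base[OF M x alg] eq by simp
qed

subsection \<open>From flags to towers\<close>

locale flag = field L for L (structure) +
  fixes K :: "'a set" and n :: nat and F :: "nat \<Rightarrow> 'a set"
  assumes subfield_K: "subfield K L" and flag: "is_flag L K n F"
begin

lemma flag_subalgebra: "i < n \<Longrightarrow> subalgebra K (F i) L"
  and flag_dimension: "i < n \<Longrightarrow> dimension (Suc i) K (F i)"
  and flag_first: "F 0 = K"
  and flag_last: "F (n - 1) = carrier L"
  and flag_Suc: "Suc i < n \<Longrightarrow> F i \<subset> F (Suc i)"
  using flag by (auto simp: is_flag_def)

lemma flag_in_carrier: "i < n \<Longrightarrow> F i \<subseteq> carrier L"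
  by (rule subalgebra_in_carrier[OF flag_subalgebra])

lemma flag_mono: "\<lbrakk> i \<le> j; j < n \<rbrakk> \<Longrightarrow> F i \<subseteq> F j"
proof (induction j rule: dec_induct)
  case (step j)
  then show ?case using flag_Suc[of j] by auto
qed simp

lemma flag_type_eq:
  assumes "i < n" "j < n"
  shows "flag_type L K n F i j = Min {k \<in> {..<n}. F i <#> F j \<subseteq> F k}"
proof -
  have "F i <#> F j \<subseteq> carrier L"
    using assms[THEN flag_in_carrier] by (rule set_mult_closed)
  then have "{k \<in> {..<n}. span_of L K (F i <#> F j) \<subseteq> F k} = {k \<in> {..<n}. F i <#> F j \<subseteq> F k}"
    using span_of_subset_iff[OF subfield_K flag_subalgebra] by (intro Collect_cong conj_cong) auto
  then show ?thesis unfolding flag_type_def by simp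
qed

lemma
  assumes "i < n" "j < n"
  shows flag_mult_subset: "F i <#> F j \<subseteq> F (flag_type L K n F i j)"
    and flag_type_le: "\<And>k. \<lbrakk> k < n; F i <#> F j \<subseteq> F k \<rbrakk> \<Longrightarrow> flag_type L K n F i j \<le> k"
proof -
  let ?S = "{k \<in> {..<n}. F i <#> F j \<subseteq> F k}"
  have fin: "finite ?S" by simp
  have "F i <#> F j \<subseteq> F (n - 1)"
    unfolding flag_last using assms[THEN flag_in_carrier] by (rule set_mult_closed)
  \<comment> \<open>The last member is all of \<open>L\<close>, so the minimum is taken over a
    non-empty set and is attained.\<close>
  then have "n - 1 \<in> ?S" using assms by simp
  then have "Min ?S \<in> ?S" using Min_in[OF fin] by blast
  then show "F i <#> F j \<subseteq> F (flag_type L K n F i j)"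
    by (simp_all add: flag_type_eq[OF assms])
  show "flag_type L K n F i j \<le> k" if "k < n" "F i <#> F j \<subseteq> F k" for k
    unfolding flag_type_eq[OF assms] using that by (intro Min_le fin) simp
qed

text \<open>\<open>F (Suc k)\<close> is only one dimension larger than \<open>F k\<close>, so a
  single new element \<open>y\<close> together with \<open>F k\<close> spans it.\<close>

lemma flag_step_subset:
  assumes "Suc k < n" "subalgebra K V L" "F k \<subseteq> V" "y \<in> V" "y \<in> F (Suc k)" "y \<notin> F k"
  shows "F (Suc k) \<subseteq> V"
proof -
  have k: "k < n" using assms(1) by simp
  obtain Us where Us: "independent K Us" "length Us = Suc k" "Span K Us = F k"
    using exists_base[OF subfield_K flag_dimension[OF k]] by auto
  have UsF: "set Us \<subseteq> F k"
    using Span_base_incl[OF subfield_K independent_in_carrier[OF Us(1)]] Us(3) by simp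
  have y: "y \<in> carrier L" using flag_in_carrier[OF assms(1)] assms(5) by auto
  have "independent K (y # Us)"
    using y assms(6) Us by (intro li_Cons) auto
  moreover have "set (y # Us) \<subseteq> F (Suc k)"
    using UsF flag_Suc[OF assms(1)] assms(5) by auto
  ultimately have "Span K (y # Us) = F (Suc k)"
    using independent_length_eq_dimension[OF subfield_K flag_dimension[OF assms(1)]] Us(2)
    by (metis length_Cons)
  moreover have "Span K (y # Us) \<subseteq> V"
    by (rule subalgebra_Span_incl[OF subfield_K assms(2)]) (use UsF assms in auto)
  ultimately show ?thesis by simp
qed

end

section \<open>Flags whose type comes from a tower type\<close>

locale flag_of_tower_type = flag L K n F + tower_degree n ns
  for L (structure) and K n F ns +
  assumes flag_type: "\<And>i j. \<lbrakk> i < n; j < n \<rbrakk> \<Longrightarrow> flag_type L K n F i j = tower_flag_type ns i j"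
begin

lemma flag_mult_subsetI:
  assumes "i < n" "j < n" "k < n" "\<And>a b. \<lbrakk> a \<le> i; b \<le> j \<rbrakk> \<Longrightarrow> digit_add ns a b \<le> k"
  shows "F i <#> F j \<subseteq> F k"
proof -
  have "tower_flag_type ns i j \<le> k"
    unfolding tower_flag_type_eq using assms by (intro Min_le) auto
  then have "flag_type L K n F i j \<le> k" using flag_type[OF assms(1,2)] by simp
  then show ?thesis
    using flag_mult_subset[OF assms(1,2)] flag_mono[of _ k] assms(3) by blast
qed

lemma flag_mult_not_subset:
  assumes "i < n" "j < n" "k < digit_add ns i j"
  shows "\<not> F i <#> F j \<subseteq> F k"
proof
  let ?S = "{k \<in> {..<n}. \<forall>a\<le>i. \<forall>b\<le>j. digit_add ns a b \<le> k}"
  have kn: "k < n" using assms(3) digit_add_less[of i j] by simp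
  assume "F i <#> F j \<subseteq> F k"
  then have "flag_type L K n F i j \<le> k" using flag_type_le[OF assms(1,2) kn] by simp
  then have "Min ?S \<le> k" using flag_type[OF assms(1,2)] tower_flag_type_eq by simp
  \<comment> \<open>Every candidate index bounds all pairs up to \<open>(i, j)\<close>, in
    particular that pair itself; \<open>n - 1\<close> shows that a candidate exists.\<close>
  moreover have "digit_add ns i j \<le> Min ?S"
  proof (rule Min.boundedI)
    have "digit_add ns a b \<le> n - 1" for a b using digit_add_less[of a b] by simp
    then have "n - 1 \<in> ?S" using assms(1) by simp
    then show "?S \<noteq> {}" by blast
  qed auto
  ultimately show False using assms(3) by simp
qed

text \<open>The type at \<open>(i, j)\<close> is exactly \<open>i + j\<close> here: smaller pairs
  stay below by \<open>digit_add_le\<close>, and the pair itself attains it. As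
  \<open>F i <#> F j\<close> consists of products, not of sums of products, the failed inclusion in
  the previous member yields a single product outside it.\<close>

lemma carry_free_mult:
  assumes "i < n" "j < n" "digit_add ns i j = i + j" "i + j > 0"
  obtains a b where "a \<in> F i" "b \<in> F j" "a \<otimes> b \<in> F (i + j)" "a \<otimes> b \<notin> F (i + j - 1)"
proof -
  have n: "i + j < n" using assms(3) digit_add_less[of i j] by simp
  have "digit_add ns a b \<le> i + j" if "a \<le> i" "b \<le> j" for a b
    using digit_add_le[of a b] that assms(1,2) by simp
  then have "F i <#> F j \<subseteq> F (i + j)" by (rule flag_mult_subsetI[OF assms(1,2) n])
  moreover have "\<not> F i <#> F j \<subseteq> F (i + j - 1)"
    using flag_mult_not_subset[OF assms(1,2)] assms(3,4) by simp
  ultimately show ?thesis using that unfolding set_mult_def by blast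
qed

text \<open>The shift accounts for \<open>F i\<close> having dimension \<open>i + 1\<close>: this
  member has dimension \<open>weight ns s\<close>.\<close>

definition layer :: "nat \<Rightarrow> 'a set" where
  "layer s = F (weight ns s - 1)"

lemma weight_pred_less: "s \<le> length ns \<Longrightarrow> weight ns s - 1 < n"
  using weight_le_degree[of s] weight_pos[of s] by simp

lemma layer_dimension: "s \<le> length ns \<Longrightarrow> dimension (weight ns s) K (layer s)"
  using flag_dimension[OF weight_pred_less, of s] weight_pos[of s] by (simp add: layer_def)

lemma K_subset_layer: "s \<le> length ns \<Longrightarrow> K \<subseteq> layer s"
  using flag_mono[of 0 "weight ns s - 1"] weight_pred_less flag_first by (simp add: layer_def)

lemma layer_mono: "\<lbrakk> s \<le> r; r \<le> length ns \<rbrakk> \<Longrightarrow> layer s \<subseteq> layer r"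
  unfolding layer_def by (intro flag_mono weight_pred_less diff_le_mono weight_mono)

text \<open>The indices below \<open>weight ns s\<close> belong to a subgroup and are closed under
  \<open>digit_add\<close>, so the type forces this member to be closed under
  multiplication.\<close>

lemma layer_subfield:
  assumes s: "s \<le> length ns"
  shows "subfield (layer s) L"
proof (rule finite_dimension_subalgebra_is_subfield[OF subfield_K])
  show "subalgebra K (layer s) L"
    unfolding layer_def by (rule flag_subalgebra[OF weight_pred_less[OF s]])
  show "finite_dimension K (layer s)" by (rule finite_dimensionI[OF layer_dimension[OF s]])
  show "\<one> \<in> layer s"
    using K_subset_layer[OF s] subringE(3)[OF subfieldE(1)[OF subfield_K]] by auto
  have "digit_add ns a b \<le> weight ns s - 1" if "a \<le> weight ns s - 1" "b \<le> weight ns s - 1" for a b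
    using digit_add_less_weight[OF s, of a b] that weight_pos[of s] by fastforce
  then have "layer s <#> layer s \<subseteq> layer s"
    unfolding layer_def by (intro flag_mult_subsetI weight_pred_less s)
  then show "a \<otimes> b \<in> layer s" if "a \<in> layer s" "b \<in> layer s" for a b
    using that by (auto simp: set_mult_def)
qed

text \<open>Tower law: both degrees over \<open>K\<close> are weights, and cancelling
  \<open>weight ns s\<close> leaves the radix.\<close>

lemma layer_relative_dimension:
  assumes s: "s < length ns"
  shows "dimension (ns ! s) (layer s) (layer (Suc s))"
proof -
  have M: "subfield (layer s) L" "subfield (layer (Suc s)) L" using s layer_subfield by auto
  have "finite_dimension (layer s) (layer (Suc s))"
  proof (rule finite_dimension_over_intermediate[OF subfield_K M(1)])
    show "K \<subseteq> layer s" using K_subset_layer s by simp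
    show "finite_dimension K (layer (Suc s))"
      using finite_dimensionI[OF layer_dimension] s by simp
    show "subalgebra (layer s) (layer (Suc s)) L"
      using subfield_is_subalgebra[OF M(2)] layer_mono[of s "Suc s"] s by simp
  qed
  then obtain m where m: "dimension m (layer s) (layer (Suc s))" by auto
  have "dimension (weight ns s) K (layer s)" using layer_dimension s by simp
  then have "dimension (weight ns s * m) K (layer (Suc s))"
    by (rule telescopic_base[OF subfield_K M(1) _ m])
  moreover have "dimension (weight ns s * ns ! s) K (layer (Suc s))"
    using layer_dimension[of "Suc s"] s by (simp add: weight_Suc)
  ultimately have "weight ns s * m = weight ns s * ns ! s"
    by (rule dimension_is_inj[OF subfield_K])
  then show ?thesis using m weight_pos[of s] by simp
qed

text \<open>Write \<open>k\<close> as \<open>q\<close> copies of the weight plus a remainder. A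
  nonzero remainder is split off, since it shares no digit position with the rest; otherwise
  \<open>q\<close> is at least 2 and one copy of the weight is split off. The index
  \<open>weight ns s\<close> itself has no such splitting, and there a generator must enter.\<close>

lemma carry_free_split:
  assumes s: "s < length ns" and k: "weight ns s < k" "k < weight ns (Suc s)"
  obtains i j where "i < k" "j < k" "digit_add ns i j = i + j" "i + j = k"
proof -
  let ?w = "weight ns s"
  obtain q r where q: "q < ns ! s" "r < ?w" and kqr: "k = q * ?w + r"
    using block_cases[OF s k(2)] by metis
  have "q \<noteq> 0"
  proof
    assume "q = 0"
    then have "k = r" using kqr by simp
    then show False using q(2) k(1) by simp
  qed
  then obtain p where p: "q = Suc p" by (cases q) auto
  have rn: "r < n" using q(2) weight_le_degree[of s] s by simp
  show ?thesis
  proof (cases "r = 0")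
    case False
    have "digit_add ns (0 * ?w + r) (q * ?w + 0) = ((0 + q) mod (ns ! s)) * ?w + digit_add ns r 0"
      by (rule digit_add_block) (use s q weight_pos[of s] in simp_all)
    then have d: "digit_add ns r (q * ?w) = r + q * ?w"
      using digit_add_0_right[OF rn] q(1) by simp
    show ?thesis
      by (rule that[OF _ _ d]) (use False p weight_pos[of s] in \<open>simp_all add: kqr\<close>)
  next
    case True
    have "p \<noteq> 0"
    proof
      assume "p = 0"
      then have "k = ?w" using kqr p True by simp
      then show False using k(1) by simp
    qed
    have "digit_add ns (1 * ?w + 0) (p * ?w + 0) = ((1 + p) mod (ns ! s)) * ?w + digit_add ns 0 0"
      by (rule digit_add_block) (use s q(1) p weight_pos[of s] \<open>p \<noteq> 0\<close> in simp_all)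
    then have d: "digit_add ns ?w (p * ?w) = ?w + p * ?w"
      using digit_add_0_right[OF degree_pos] q(1) p by simp
    show ?thesis
      by (rule that[OF _ _ d])
         (use True p \<open>p \<noteq> 0\<close> weight_pos[of s] in \<open>simp_all add: kqr\<close>)
  qed
qed

text \<open>Induction along the flag. Up to the layer the inclusion is given; at
  \<open>weight ns s\<close> the new element is \<open>x\<close>; beyond, the new element is a
  product of elements of two earlier members, which lie in \<open>E\<close> by induction.\<close>

lemma flag_subset_subfield:
  assumes s: "s < length ns" and E: "subfield E L" "layer s \<subseteq> E" and x: "x \<in> E"
    "x \<in> F (weight ns s)" "x \<notin> layer s"
  shows "k < weight ns (Suc s) \<Longrightarrow> F k \<subseteq> E"
proof (induction k rule: less_induct)
  case (less k)
  have wn: "weight ns (Suc s) \<le> n" using weight_le_degree s by simp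
  then have kn: "k < n" using less.prems by simp
  have KE: "subalgebra K E L"
    using subfield_is_subalgebra[OF E(1)] K_subset_layer[of s] s E(2) by auto
  consider "k < weight ns s" | "k = weight ns s" | "weight ns s < k" by linarith
  then show ?case
  proof cases
    case 1
    then have "F k \<subseteq> layer s"
      unfolding layer_def using weight_pred_less[of s] s by (intro flag_mono) auto
    then show ?thesis using E(2) by auto
  next
    case 2
    then have k: "Suc (weight ns s - 1) = k" using weight_pos[of s] by simp
    have "F (Suc (weight ns s - 1)) \<subseteq> E"
      by (rule flag_step_subset[OF _ KE _ x(1)]) (use E(2) x(2,3) kn 2 k in \<open>simp_all add: layer_def\<close>)
    then show ?thesis by (simp only: k)
  next
    case 3
    obtain i j where ij: "i < k" "j < k" "digit_add ns i j = i + j" "i + j = k"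
      by (rule carry_free_split[OF s 3 less.prems])
    obtain a b where ab: "a \<in> F i" "b \<in> F j" "a \<otimes> b \<in> F (i + j)" "a \<otimes> b \<notin> F (i + j - 1)"
      by (rule carry_free_mult[of i j]) (use ij kn in auto)
    have "a \<in> E" "b \<in> E" using ab less.IH[of i] less.IH[of j] ij less.prems by auto
    then have abE: "a \<otimes> b \<in> E" using subringE(6)[OF subfieldE(1)[OF E(1)]] by simp
    have k: "Suc (k - 1) = k" using ij(1) by simp
    have IH: "F (k - 1) \<subseteq> E" using less.IH[of "k - 1"] less.prems ij(1) by simp
    have "F (Suc (k - 1)) \<subseteq> E"
      by (rule flag_step_subset[OF _ KE IH abE]) (use k kn ab(3,4) ij(4) in \<open>simp_all only: not_False_eq_True\<close>)
    then show ?thesis by (simp only: k)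
  qed
qed

text \<open>Any element of the first member after the layer that is not in the layer generates,
  because \<open>flag_subset_subfield\<close> applies to the field it generates.\<close>

lemma layer_simple_extension:
  assumes s: "s < length ns"
  shows "is_simple_extension L (layer s) (layer (Suc s))"
proof -
  have wn: "weight ns s < n" using weight_less_Suc[OF s] weight_le_degree[of "Suc s"] s by simp
  have "F (weight ns s - 1) \<subset> F (weight ns s)"
    using flag_Suc[of "weight ns s - 1"] wn weight_pos[of s] by simp
  then obtain x where x: "x \<in> F (weight ns s)" "x \<notin> layer s" unfolding layer_def by auto
  have M: "subfield (layer s) L" "subfield (layer (Suc s)) L" using s layer_subfield by auto
  have carr: "insert x (layer s) \<subseteq> carrier L"
    using x(1) flag_in_carrier[OF wn] subfieldE(3)[OF M(1)] by auto
  have "F (weight ns s) \<subseteq> layer (Suc s)"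
    unfolding layer_def using weight_less_Suc[OF s] weight_pred_less[of "Suc s"] s
    by (intro flag_mono) auto
  then have x': "x \<in> layer (Suc s)" using x by auto
  let ?E = "generate_field L (insert x (layer s))"
  have "?E \<subseteq> layer (Suc s)"
    using generate_field_min_subfield1[OF carr M(2)] x' layer_mono[of s "Suc s"] s by simp
  moreover have "layer (Suc s) \<subseteq> ?E"
    unfolding layer_def[of "Suc s"]
    by (rule flag_subset_subfield[OF s generate_field_is_subfield[OF carr] _ _ x])
       (use weight_pos[of "Suc s"] in \<open>auto intro: generate_field.incl\<close>)
  ultimately show ?thesis unfolding is_simple_extension_def using x' by auto
qed

lemma is_simple_tower_layer: "is_simple_tower L K ns layer"
  unfolding is_simple_tower_def
proof (intro conjI allI impI)
  show "layer 0 = K" by (simp add: layer_def flag_first)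
  show "layer (length ns) = carrier L" by (simp only: layer_def weight_length flag_last)
  fix s assume s: "s < length ns"
  have "layer s \<noteq> layer (s + 1)"
  proof
    assume "layer s = layer (s + 1)"
    then have "weight ns s = weight ns (Suc s)"
      using dimension_is_inj[OF subfield_K layer_dimension[of s]] layer_dimension[of "Suc s"] s by simp
    then show False using weight_less_Suc[OF s] by simp
  qed
  then show "layer s \<subset> layer (s + 1)" using layer_mono[of s "s + 1"] s by auto
  show "dimension (ns ! s) (layer s) (layer (s + 1))"
    using layer_relative_dimension[OF s] by simp
  show "is_simple_extension L (layer s) (layer (s + 1))"
    using layer_simple_extension[OF s] by simp
qed (rule layer_subfield)

end

subsection \<open>From towers to flags\<close>

text \<open>The generators are a parameter, since \<open>is_simple_tower\<close> only asserts that
  they exist.\<close>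

locale simple_tower = field L + tower_degree n ns
  for L (structure) and n ns +
  fixes K :: "'a set" and M :: "nat \<Rightarrow> 'a set" and x :: "nat \<Rightarrow> 'a"
  assumes subfield_K: "subfield K L"
    and dimension_L: "dimension n K (carrier L)"
    and tower: "is_simple_tower L K ns M"
    and generator: "s < length ns \<Longrightarrow> M (Suc s) = generate_field L (insert (x s) (M s))"
begin

lemma tower_subfield: "s \<le> length ns \<Longrightarrow> subfield (M s) L"
  and tower_bottom: "M 0 = K"
  and tower_top: "M (length ns) = carrier L"
  and tower_dimension: "s < length ns \<Longrightarrow> dimension (ns ! s) (M s) (M (Suc s))"
  and tower_Suc: "s < length ns \<Longrightarrow> M s \<subseteq> M (Suc s)"
  using tower by (auto simp: is_simple_tower_def)

lemma generator_mem: "s < length ns \<Longrightarrow> x s \<in> M (Suc s)"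
  using generator[of s] by (auto intro: generate_field.incl)

lemma generator_closed: "s < length ns \<Longrightarrow> x s \<in> carrier L"
  using generator_mem[of s] subfieldE(3)[OF tower_subfield, of "Suc s"] by auto

lemma K_subset_tower: "s \<le> length ns \<Longrightarrow> K \<subseteq> M s"
proof (induction s)
  case (Suc s)
  then show ?case using tower_Suc[of s] by simp
qed (simp add: tower_bottom)

section \<open>Monomials in the generators of the tower\<close>

definition monomial :: "nat \<Rightarrow> 'a" where
  "monomial a = (\<Otimes>s\<in>{..<length ns}. x s [^] mixed_digit ns a s)"

lemma monomial_closed [simp]: "monomial a \<in> carrier L"
  unfolding monomial_def using generator_closed by (intro finprod_closed) auto

lemma monomial_0: "monomial 0 = \<one>"
proof -
  have "mixed_digit ns 0 s = 0" for s by (simp add: mixed_digit_def)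
  then show ?thesis by (simp add: monomial_def)
qed

lemma monomial_block:
  assumes s: "s < length ns" "d < ns ! s" "a < weight ns s"
  shows "monomial (d * weight ns s + a) = x s [^] d \<otimes> monomial a"
proof -
  \<comment> \<open>\<open>?f\<close> isolates the leading factor at position \<open>s\<close>, so
    that the product over all positions separates into \<open>x s [^] d\<close> and
    \<open>monomial a\<close>.\<close>
  let ?f = "\<lambda>r. if s = r then x s [^] d else \<one>"
  let ?g = "\<lambda>r. x r [^] mixed_digit ns a r"
  have cl: "?f \<in> {..<length ns} \<rightarrow> carrier L" "?g \<in> {..<length ns} \<rightarrow> carrier L"
    using generator_closed s(1) by auto
  have "monomial (d * weight ns s + a) = (\<Otimes>r\<in>{..<length ns}. ?f r \<otimes> ?g r)"
    unfolding monomial_def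
  proof (rule finprod_cong'[OF refl])
    show "(\<lambda>r. ?f r \<otimes> ?g r) \<in> {..<length ns} \<rightarrow> carrier L" using cl by blast
    fix r assume r: "r \<in> {..<length ns}"
    have "mixed_digit ns a r = 0" if "s \<le> r" using mixed_digit_high[OF s(3) that] .
    then show "x r [^] mixed_digit ns (d * weight ns s + a) r = ?f r \<otimes> ?g r"
      using mixed_digit_block[OF s, of r] generator_closed[of r] r
      by (cases "r < s"; cases "r = s") auto
  qed
  also have "\<dots> = (\<Otimes>r\<in>{..<length ns}. ?f r) \<otimes> monomial a"
    unfolding monomial_def by (rule finprod_multf[OF cl])
  also have "(\<Otimes>r\<in>{..<length ns}. ?f r) = x s [^] d"
    using finprod_singleton[of s "{..<length ns}" "\<lambda>_. x s [^] d"] s(1) generator_closed by simp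
  finally show ?thesis .
qed

text \<open>In a carry-free sum the digits add position by position, so the exponents match
  exactly.\<close>

lemma monomial_mult:
  assumes "a < n" "b < n" "digit_add ns a b = a + b"
  shows "monomial a \<otimes> monomial b = monomial (a + b)"
proof -
  have "mixed_digit ns (a + b) s = mixed_digit ns a s + mixed_digit ns b s" if "s < length ns" for s
    using mixed_digit_digit_add[OF that, of a b] carry_free_digits[OF assms that] assms(3) by simp
  then have "monomial (a + b) = (\<Otimes>s\<in>{..<length ns}. x s [^] mixed_digit ns a s \<otimes> x s [^] mixed_digit ns b s)"
    unfolding monomial_def using generator_closed
    by (intro finprod_cong') (auto simp: nat_pow_mult)
  also have "\<dots> = monomial a \<otimes> monomial b"
    unfolding monomial_def using generator_closed by (intro finprod_multf) auto
  finally show ?thesis by simp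
qed

text \<open>The list runs downwards because spans and independence recurse on the head: the newest
  monomial comes first, and shorter lists are suffixes of longer ones.\<close>

definition basis :: "nat \<Rightarrow> 'a list" where
  "basis i = map monomial (rev [0..<Suc i])"

definition space :: "nat \<Rightarrow> 'a set" where
  "space i = Span K (basis i)"

lemma set_basis: "set (basis i) = monomial ` {..i}"
  by (simp only: basis_def set_map set_rev set_upt atLeast0LessThan lessThan_Suc_atMost)

lemma basis_in_carrier: "set (basis i) \<subseteq> carrier L"
  unfolding set_basis using monomial_closed by blast

lemma space_subalgebra: "subalgebra K (space i) L"
  unfolding space_def by (rule Span_is_subalgebra[OF subfield_K basis_in_carrier])

lemma space_in_carrier: "space i \<subseteq> carrier L"
  by (rule subalgebra_in_carrier[OF space_subalgebra])

lemma monomial_in_space: "a \<le> i \<Longrightarrow> monomial a \<in> space i"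
  unfolding space_def using Span_base_incl[OF subfield_K basis_in_carrier[of i]] set_basis[of i] by auto

lemma space_subset:
  assumes "subalgebra K V L" "\<And>a. a \<le> i \<Longrightarrow> monomial a \<in> V"
  shows "space i \<subseteq> V"
  unfolding space_def
  by (rule subalgebra_Span_incl[OF subfield_K assms(1)]) (use assms(2) set_basis in auto)

lemma space_mono: "i \<le> j \<Longrightarrow> space i \<subseteq> space j"
  by (rule space_subset[OF space_subalgebra]) (simp add: monomial_in_space)

text \<open>Linearity in the left factor, through \<open>subalgebra_colon\<close>.\<close>

lemma space_multI:
  assumes V: "subalgebra K V L" and y: "y \<in> carrier L"
    and mon: "\<And>a. a \<le> i \<Longrightarrow> monomial a \<otimes> y \<in> V" and u: "u \<in> space i"
  shows "u \<otimes> y \<in> V"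
proof -
  have "space i \<subseteq> {c \<in> carrier L. c \<otimes> y \<in> V}"
    by (rule space_subset[OF subalgebra_colon[OF subfieldE(3)[OF subfield_K] V y]]) (simp add: mon)
  then show ?thesis using u by auto
qed

lemma space_mult_subset:
  assumes V: "subalgebra K V L"
    and mon: "\<And>a b. \<lbrakk> a \<le> i; b \<le> j \<rbrakk> \<Longrightarrow> monomial a \<otimes> monomial b \<in> V"
  shows "space i <#> space j \<subseteq> V"
proof -
  have "u \<otimes> v \<in> V" if u: "u \<in> space i" and v: "v \<in> space j" for u v
  proof (rule space_multI[OF V _ _ u])
    show vc: "v \<in> carrier L" using v space_in_carrier by auto
    fix a assume a: "a \<le> i"
    \<comment> \<open>Commutativity moves the second factor to the left, so
      \<open>space_multI\<close> applies once more.\<close>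
    have "v \<otimes> monomial a \<in> V"
    proof (rule space_multI[OF V _ _ v])
      show "monomial b \<otimes> monomial a \<in> V" if "b \<le> j" for b
        using mon[OF a that] by (simp add: m_comm)
    qed simp
    then show "monomial a \<otimes> v \<in> V" using vc by (simp add: m_comm)
  qed
  then show ?thesis unfolding set_mult_def by auto
qed

text \<open>Induction up the tower. A monomial of index below \<open>weight ns (Suc s)\<close> is a
  power of \<open>x s\<close> times a monomial in \<open>M s\<close>. Conversely,
  \<open>M (Suc s)\<close> is spanned over \<open>M s\<close> by the powers of \<open>x s\<close>
  below \<open>ns ! s\<close>.\<close>

lemma tower_eq_space:
  assumes "s \<le> length ns"
  shows "M s = space (weight ns s - 1)"
  using assms
proof (induction s)
  case 0
  have K: "subalgebra K K L" by (rule subfield_is_subalgebra[OF subfield_K]) simp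
  have "space 0 \<subseteq> K"
    by (rule space_subset[OF K])
       (use subringE(3)[OF subfieldE(1)[OF subfield_K]] in \<open>simp add: monomial_0\<close>)
  moreover have "K \<subseteq> space 0"
  proof
    fix k assume k: "k \<in> K"
    have "\<one> \<in> space 0" using monomial_in_space[of 0 0] by (simp add: monomial_0)
    then have "k \<otimes> \<one> \<in> space 0" by (rule subalgebra.smult_closed[OF space_subalgebra k])
    then show "k \<in> space 0" using k subfieldE(3)[OF subfield_K] by auto
  qed
  ultimately show ?case by (simp add: tower_bottom)
next
  case (Suc s)
  then have s: "s < length ns" and IH: "M s = space (weight ns s - 1)" by auto
  have N: "subfield (M (Suc s)) L" and Ms: "subfield (M s) L" using tower_subfield s by auto
  let ?V = "space (weight ns (Suc s) - 1)"
  have xs: "x s \<in> carrier L" by (rule generator_closed[OF s])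
  have pow: "x s [^] d \<in> M (Suc s)" for d :: nat
  proof (induction d)
    case 0
    show ?case using subringE(3)[OF subfieldE(1)[OF N]] by simp
  next
    case (Suc d)
    then show ?case using subringE(6)[OF subfieldE(1)[OF N]] generator_mem[OF s] by simp
  qed
  have "?V \<subseteq> M (Suc s)"
  proof (rule space_subset)
    show "subalgebra K (M (Suc s)) L"
      using subfield_is_subalgebra[OF N] K_subset_tower s by simp
    fix a assume "a \<le> weight ns (Suc s) - 1"
    then have "a < weight ns (Suc s)" using weight_pos[of "Suc s"] by simp
    then obtain d a0 where a: "d < ns ! s" "a0 < weight ns s" "a = d * weight ns s + a0"
      using block_cases[OF s] by metis
    have "monomial a0 \<in> M (Suc s)"
      using monomial_in_space[of a0 "weight ns s - 1"] IH tower_Suc[OF s] a(2) by auto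
    then show "monomial a \<in> M (Suc s)"
      using monomial_block[OF s a(1,2)] a(3) pow[of d] subringE(6)[OF subfieldE(1)[OF N]] by simp
  qed
  moreover have "M (Suc s) \<subseteq> ?V"
  proof -
    have "dimension (ns ! s) (M s) (generate_field L (insert (x s) (M s)))"
      using tower_dimension[OF s] generator[OF s] by simp
    then have "M (Suc s) = Span (M s) (exp_base (x s) (ns ! s))"
      using simple_extension_eq_Span[OF Ms xs] generator[OF s] by simp
    also have "\<dots> \<subseteq> ?V"
    proof (rule Span_min[OF Ms exp_base_closed[OF xs] subalgebra.axioms(1)[OF space_subalgebra]])
      \<comment> \<open>The coefficient \<open>c\<close> ranges over a span of monomials, so
        linearity leaves a lower monomial times a power of \<open>x s\<close>, which is again a
        monomial.\<close>
      have "c \<otimes> x s [^] d \<in> ?V" if c: "c \<in> M s" and d: "d < ns ! s" for c d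
      proof (rule space_multI[OF space_subalgebra])
        show "x s [^] d \<in> carrier L" using xs by simp
        show "c \<in> space (weight ns s - 1)" using c IH by simp
        fix a assume "a \<le> weight ns s - 1"
        then have a: "a < weight ns s" using weight_pos[of s] by simp
        have "monomial (d * weight ns s + a) \<in> ?V"
          using block_less[OF s d a] by (intro monomial_in_space) simp
        then show "monomial a \<otimes> x s [^] d \<in> ?V"
          using monomial_block[OF s d a] xs by (simp add: m_comm)
      qed
      then show "M s <#> set (exp_base (x s) (ns ! s)) \<subseteq> ?V"
        by (auto simp: set_mult_def exp_base_def)
    qed
    finally show ?thesis .
  qed
  ultimately show ?case by simp
qed

lemma space_last: "space (n - 1) = carrier L"
  using tower_eq_space[of "length ns"] by (simp only: tower_top weight_length le_refl simp_thms)

text \<open>The full list has \<open>n\<close> entries and spans a space of dimension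
  \<open>n\<close>, so it is independent, and so is its suffix \<open>basis i\<close>.\<close>

lemma basis_independent:
  assumes "i < n"
  shows "independent K (basis i)"
proof -
  have "Suc (n - 1) = n" using degree_pos by simp
  then have "length (basis (n - 1)) = n" by (simp only: basis_def length_map length_rev length_upt diff_zero)
  then have "independent K (basis (n - 1))"
    using spanning_list_independent[OF subfield_K basis_in_carrier, of "n - 1"] dimension_L space_last
    by (simp only: space_def[symmetric])
  moreover have "basis (n - 1) = map monomial (rev [Suc i..<n]) @ basis i"
  proof -
    have "[0..<n] = [0..<Suc i] @ [Suc i..<n]"
      using assms by (metis Suc_leI le_add_diff_inverse upt_add_eq_append zero_le)
    then show ?thesis unfolding basis_def \<open>Suc (n - 1) = n\<close> by (simp only: rev_append map_append)
  qed
  ultimately show ?thesis using independent_split(1)[OF subfield_K] by metis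
qed

lemma basis_Suc: "basis (Suc i) = monomial (Suc i) # basis i"
  by (simp add: basis_def)

lemma monomial_notin_space:
  assumes "k < m" "m < n"
  shows "monomial m \<notin> space k"
proof -
  obtain i where m: "m = Suc i" using assms(1) by (cases m) auto
  have "monomial m \<notin> space i"
    using independent_backwards(1)[of K "monomial m" "basis i"] basis_independent[OF assms(2)]
    unfolding space_def m basis_Suc by simp
  then show ?thesis using space_mono[of k i] assms(1) m by auto
qed

lemma is_flag_space: "is_flag L K n space"
  unfolding is_flag_def
proof (intro conjI allI impI)
  show "space 0 = K" using tower_eq_space[of 0] tower_bottom by simp
  show "space (n - 1) = carrier L" by (rule space_last)
  show "subalgebra K (space i) L" for i by (rule space_subalgebra)
  show "dimension (i + 1) K (space i)" if "i < n" for i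
    using dimension_independent[OF basis_independent[OF that]] by (simp add: space_def basis_def)
  show "space i \<subset> space (i + 1)" if "i + 1 < n" for i
    using space_mono[of i "i + 1"] monomial_notin_space[of i "i + 1"]
      monomial_in_space[of "i + 1" "i + 1"] that by auto
qed

section \<open>Products in the flag spanned by monomials\<close>

lemma power_mult_space:
  assumes s: "s < length ns" and d: "d < ns ! s" and c: "c < weight ns s" and u: "u \<in> space c"
  shows "x s [^] d \<otimes> u \<in> space (d * weight ns s + c)"
proof -
  have xs: "x s \<in> carrier L" by (rule generator_closed[OF s])
  have "u \<otimes> x s [^] d \<in> space (d * weight ns s + c)"
  proof (rule space_multI[OF space_subalgebra _ _ u])
    fix a assume a: "a \<le> c"
    then have "monomial (d * weight ns s + a) \<in> space (d * weight ns s + c)"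
      by (intro monomial_in_space) simp
    then show "monomial a \<otimes> x s [^] d \<in> space (d * weight ns s + c)"
      using monomial_block[OF s d, of a] a c xs by (simp add: m_comm)
  qed (use xs in simp)
  then show ?thesis using xs space_in_carrier u by (simp add: m_comm subset_iff)
qed

text \<open>If the top digits of \<open>a\<close> and \<open>b\<close> produce a carry, then \<open>a\<close> can be lowered to the
  complement of \<open>b\<close>, whose carry-free sum with \<open>b\<close> is already the largest possible value.\<close>

lemma carry_free_dominating:
  assumes "s \<le> length ns" "a < weight ns s" "b < weight ns s"
  shows "\<exists>a'\<le>a. \<exists>b'\<le>b. digit_add ns a' b' = a' + b' \<and> a' + b' < weight ns s \<and>
           digit_add ns a b \<le> a' + b' \<and> monomial a \<otimes> monomial b \<in> space (a' + b')"
  using assms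
proof (induction s arbitrary: a b)
  case 0
  then have "a = 0" "b = 0" by auto
  moreover have "monomial 0 \<otimes> monomial 0 \<in> space 0"
    using monomial_in_space[of 0 0] by (simp add: monomial_0)
  ultimately show ?case using digit_add_0_right[OF degree_pos] by simp
next
  case (Suc s)
  then have s: "s < length ns" by simp
  let ?w = "weight ns s" and ?N = "weight ns (Suc s)"
  obtain d a0 where a: "d < ns ! s" "a0 < ?w" and a_eq: "a = d * ?w + a0"
    using block_cases[OF s Suc.prems(2)] by metis
  obtain e b0 where b: "e < ns ! s" "b0 < ?w" and b_eq: "b = e * ?w + b0"
    using block_cases[OF s Suc.prems(3)] by metis
  show ?case
  proof (cases "d + e < ns ! s")
    case True
    \<comment> \<open>The top digits \<open>d\<close> and \<open>e\<close> are kept and the lower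
      blocks are replaced by induction; \<open>power_mult_space\<close> then restores the factor
      \<open>x s [^] (d + e)\<close>.\<close>
    obtain a' b' where ab': "a' \<le> a0" "b' \<le> b0" "digit_add ns a' b' = a' + b'" "a' + b' < ?w"
      "digit_add ns a0 b0 \<le> a' + b'" "monomial a0 \<otimes> monomial b0 \<in> space (a' + b')"
      using Suc.IH[of a0 b0] s a(2) b(2) by auto
    have sum: "(d * ?w + a') + (e * ?w + b') = (d + e) * ?w + (a' + b')"
      by (simp add: add_mult_distrib)
    have xs: "x s \<in> carrier L" by (rule generator_closed[OF s])
    have "monomial a \<otimes> monomial b = (x s [^] d \<otimes> x s [^] e) \<otimes> (monomial a0 \<otimes> monomial b0)"
      unfolding a_eq b_eq monomial_block[OF s a] monomial_block[OF s b]
      using xs by (simp add: m_ac)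
    also have "\<dots> = x s [^] (d + e) \<otimes> (monomial a0 \<otimes> monomial b0)"
      using xs by (simp add: nat_pow_mult)
    finally have "monomial a \<otimes> monomial b \<in> space ((d + e) * ?w + (a' + b'))"
      using power_mult_space[OF s True ab'(4,6)] by simp
    moreover have "digit_add ns (d * ?w + a') (e * ?w + b') = (d + e) * ?w + (a' + b')"
      using digit_add_block[OF s a(1) b(1), of a' b'] ab' a(2) b(2) True by simp
    moreover have "digit_add ns a b \<le> (d + e) * ?w + (a' + b')"
      using digit_add_block[OF s a(1) b(1) a(2) b(2)] ab'(5) True by (simp add: a_eq b_eq)
    moreover have "(d + e) * ?w + (a' + b') < ?N" by (rule block_less[OF s True ab'(4)])
    moreover have "d * ?w + a' \<le> a" "e * ?w + b' \<le> b" using ab' by (simp_all add: a_eq b_eq)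
    ultimately show ?thesis unfolding sum[symmetric] by blast
  next
    case False
    let ?a' = "?N - 1 - b"
    have N: "?a' + b = ?N - 1" using Suc.prems(3) by simp
    \<comment> \<open>A carry at position \<open>s\<close> makes the ordinary sum at least
      \<open>?N\<close>, which puts the complement of \<open>b\<close> at or below
      \<open>a\<close>.\<close>
    have "ns ! s * ?w \<le> (d + e) * ?w" using False by (intro mult_right_mono) auto
    also have "\<dots> \<le> a + b" unfolding a_eq b_eq add_mult_distrib by simp
    finally have "?N \<le> a + b" by (simp only: weight_Suc[OF s] mult.commute)
    then have "?a' \<le> a" by simp
    moreover have "digit_add ns ?a' b = ?a' + b"
      using digit_add_complement[OF Suc.prems(1,3)] N by simp
    moreover have "?a' + b < ?N" using N weight_pos[of "Suc s"] by simp
    moreover have "digit_add ns a b \<le> ?a' + b"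
      using digit_add_less_weight[OF Suc.prems] N by simp
    moreover have "monomial a \<otimes> monomial b \<in> space (?a' + b)"
    proof -
      \<comment> \<open>The product is placed only in the subfield \<open>M (Suc s)\<close>, but
        this field is \<open>space (?N - 1)\<close>, exactly the target.\<close>
      have "monomial a \<in> M (Suc s)" "monomial b \<in> M (Suc s)"
        using Suc.prems tower_eq_space[OF Suc.prems(1)] by (auto intro!: monomial_in_space)
      then have "monomial a \<otimes> monomial b \<in> M (Suc s)"
        by (rule subringE(6)[OF subfieldE(1)[OF tower_subfield[OF Suc.prems(1)]]])
      then show ?thesis unfolding N using tower_eq_space[OF Suc.prems(1)] by simp
    qed
    ultimately show ?thesis by blast
  qed
qed

text \<open>Both directions go through dominating carry-free pairs. Such a pair multiplies to the
  monomial of index \<open>a' + b'\<close>, which lies in no space of smaller index; and every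
  product of two monomials lies in the space of that index for some such pair.\<close>

lemma space_mult_subset_iff:
  assumes "i < n" "j < n" "k < n"
  shows "space i <#> space j \<subseteq> space k \<longleftrightarrow> (\<forall>a\<le>i. \<forall>b\<le>j. digit_add ns a b \<le> k)"
proof -
  have dom: "\<exists>a'\<le>a. \<exists>b'\<le>b. digit_add ns a' b' = a' + b' \<and> a' + b' < n \<and>
      digit_add ns a b \<le> a' + b' \<and> monomial a \<otimes> monomial b \<in> space (a' + b')"
    if "a \<le> i" "b \<le> j" for a b
    using carry_free_dominating[of "length ns" a b] that assms by simp
  show ?thesis
  proof (intro iffI allI impI)
    assume sub: "space i <#> space j \<subseteq> space k"
    fix a b assume ab: "a \<le> i" "b \<le> j"
    obtain a' b' where ab': "a' \<le> a" "b' \<le> b" "digit_add ns a' b' = a' + b'" "a' + b' < n"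
      "digit_add ns a b \<le> a' + b'"
      using dom[OF ab] by blast
    have "monomial a' \<in> space i" "monomial b' \<in> space j"
      using ab ab' by (simp_all add: monomial_in_space)
    then have "monomial a' \<otimes> monomial b' \<in> space k" using sub by (auto simp: set_mult_def)
    then have "monomial (a' + b') \<in> space k"
      using monomial_mult[OF _ _ ab'(3)] ab'(4) by simp
    then have "a' + b' \<le> k" using monomial_notin_space[OF _ ab'(4)] by (meson not_le)
    then show "digit_add ns a b \<le> k" using ab'(5) by simp
  next
    assume le: "\<forall>a\<le>i. \<forall>b\<le>j. digit_add ns a b \<le> k"
    show "space i <#> space j \<subseteq> space k"
    proof (rule space_mult_subset[OF space_subalgebra])
      fix a b assume ab: "a \<le> i" "b \<le> j"
      obtain a' b' where ab': "a' \<le> a" "b' \<le> b" "digit_add ns a' b' = a' + b'"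
        "monomial a \<otimes> monomial b \<in> space (a' + b')"
        using dom[OF ab] by blast
      have "a' \<le> i" "b' \<le> j" using ab ab' by auto
      then have "a' + b' \<le> k" using le ab'(3) by metis
      then show "monomial a \<otimes> monomial b \<in> space k" using space_mono ab'(4) by blast
    qed
  qed
qed

lemma realizable: "realizable L K n (tower_flag_type ns)"
proof -
  interpret flag L K n space
    by (intro flag.intro flag_axioms.intro field_axioms subfield_K is_flag_space)
  have "flag_type L K n space i j = tower_flag_type ns i j" if "i < n" "j < n" for i j
    unfolding flag_type_eq[OF that] tower_flag_type_eq
    by (intro arg_cong[of _ _ Min] Collect_cong conj_cong refl space_mult_subset_iff) (use that in auto)
  then show ?thesis unfolding realizable_def using is_flag_space by blast
qed

end

theorem theorem1p9:
  fixes L :: "('a, 'b) ring_scheme" and K :: "'a set" and n :: nat and ns :: "nat list"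
  assumes "field L"
    and "subfield K L"
    and "ring.dimension L n K (carrier L)"
    and "tower_type n ns"
  shows "realizable L K n (tower_flag_type ns) \<longleftrightarrow> (\<exists>M. is_simple_tower L K ns M)"
proof
  interpret field L by (rule assms(1))
  assume "realizable L K n (tower_flag_type ns)"
  then obtain F where F: "is_flag L K n F"
    "\<And>i j. \<lbrakk> i < n; j < n \<rbrakk> \<Longrightarrow> flag_type L K n F i j = tower_flag_type ns i j"
    unfolding realizable_def by blast
  interpret flag_of_tower_type L K n F ns
    by (intro flag_of_tower_type.intro flag.intro flag_axioms.intro tower_degree.intro
        flag_of_tower_type_axioms.intro assms F)
  show "\<exists>M. is_simple_tower L K ns M" using is_simple_tower_layer by blast
next
  interpret field L by (rule assms(1))
  assume "\<exists>M. is_simple_tower L K ns M"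
  then obtain M where M: "is_simple_tower L K ns M" by blast
  then have "\<forall>s\<in>{..<length ns}. \<exists>x. M (Suc s) = generate_field L (insert x (M s))"
    unfolding is_simple_tower_def is_simple_extension_def Suc_eq_plus1 by blast
  \<comment> \<open>One generator is chosen for each step of the tower; beyond
    \<open>length ns\<close> the values of \<open>x\<close> are arbitrary.\<close>
  then obtain x where "\<forall>s\<in>{..<length ns}. M (Suc s) = generate_field L (insert (x s) (M s))"
    by (rule bchoice[THEN exE])
  then have x: "M (Suc s) = generate_field L (insert (x s) (M s))" if "s < length ns" for s
    using that by simp
  interpret simple_tower L n ns K M x
    by (intro simple_tower.intro simple_tower_axioms.intro tower_degree.intro assms M x)
  show "realizable L K n (tower_flag_type ns)" by (rule realizable)
qed

end
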